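(* Let $A\in\mathbb{R}^{n\times n}$ be a group monotone matrix and let $A=K-L=U-V=X-Y$ be three proper G-weak regular splittings of type II of $A$. Then the matrix $\mathcal{H}=X^{\#}YU^{\#}VK^{\#}L$ satisfies $\rho(\mathcal{H})<1$.
   Context: All matrices are real $n\times n$; $\mathcal{R}(\cdot)$, $\mathcal{N}(\cdot)$ denote range and null space; $\rho$ is the spectral radius; $B\ge 0$ means entrywise nonnegative. The group inverse of $A$, when it exists, is the unique matrix $A^{\#}$ with $AA^{\#}A=A$, $A^{\#}AA^{\#}=A^{\#}$, $AA^{\#}=A^{\#}A$; it exists iff $\mathrm{rank}(A)=\mathrm{rank}(A^2)$ ("index 1"). $A$ is group monotone if $A^{\#}$ exists and $A^{\#}\ge 0$. An expression $A=U-V$ is a proper splitting of $A$ if $\mathcal{R}(U)=\mathcal{R}(A)$ and $\mathcal{N}(U)=\mathcal{N}(A)$. A proper splitting $A=U-V$ is a proper G-weak regular splitting of type II if $U^{\#}$ exists, $U^{\#}\ge 0$ and $VU^{\#}\ge 0$. *)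

theory Defs
  imports
    "Jordan_Normal_Form.Matrix_Kernel"
    "Jordan_Normal_Form.Spectral_Radius"
begin

definition mat_range :: "real mat \<Rightarrow> real vec set" where
  "mat_range A = (\<lambda>x. A *\<^sub>v x) ` carrier_vec (dim_col A)"

lemma mat_range_eq_col_space:
  assumes "A \<in> carrier_mat n m"
  shows "mat_range A = vec_space.col_space n A"
proof -
  have "vec_space.col_space n A =
      {y \<in> carrier_vec (dim_row A). \<exists>x\<in>carrier_vec (dim_col A). A *\<^sub>v x = y}"
    by (rule vec_space.col_space_eq[OF assms])
  then show ?thesis
    using assms by (auto simp: mat_range_def)
qed

text \<open>Matrix multiplication and addition are total operations on \<^typ>\<open>real mat\<close>, so the
  dimensions are part of each definition.\<close>

definition is_group_inverse :: "real mat \<Rightarrow> real mat \<Rightarrow> bool" where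
  "is_group_inverse A X \<longleftrightarrow>
     square_mat A \<and> X \<in> carrier_mat (dim_row A) (dim_row A) \<and>
     A * X * A = A \<and> X * A * X = X \<and> A * X = X * A"

definition group_invertible :: "real mat \<Rightarrow> bool" where
  "group_invertible A \<longleftrightarrow> (\<exists>X. is_group_inverse A X)"

text \<open>Meaningful only under \<^const>\<open>group_invertible\<close>.\<close>

definition group_inverse :: "real mat \<Rightarrow> real mat" where
  "group_inverse A = (THE X. is_group_inverse A X)"

lemma is_group_inverse_unique:
  assumes "is_group_inverse A X" "is_group_inverse A Y"
  shows "X = Y"
proof -
  define n where "n = dim_row A"
  have c: "A \<in> carrier_mat n n" "X \<in> carrier_mat n n" "Y \<in> carrier_mat n n"
    using assms by (auto simp: is_group_inverse_def n_def)
  have X: "A * X * A = A" "X * A * X = X" "A * X = X * A"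
    and Y: "A * Y * A = A" "Y * A * Y = Y" "A * Y = Y * A"
    using assms by (auto simp: is_group_inverse_def)
  note as = assoc_mult_mat[of _ n n _ n _ n]
  have "A * X = (A * Y * A) * X" by (simp only: Y(1))
  also have "\<dots> = (Y * A) * (A * X)" unfolding Y(3) using c by (simp add: as)
  also have "\<dots> = (Y * A) * (X * A)" by (simp only: X(3))
  also have "\<dots> = Y * (A * X * A)" using c by (simp add: as)
  also have "\<dots> = A * Y" by (simp only: X(1) Y(3))
  finally have AX: "A * X = A * Y" .
  have "X = X * (A * X)" using X(2) c by (simp add: as)
  also have "\<dots> = X * A * Y" unfolding AX using c by (simp add: as)
  also have "\<dots> = Y * A * Y" using AX X(3) Y(3) by simp
  also have "\<dots> = Y" by (rule Y(2))
  finally show ?thesis .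
qed

lemma is_group_inverse_group_inverse:
  assumes "group_invertible A"
  shows "is_group_inverse A (group_inverse A)"
  using assms is_group_inverse_unique
  unfolding group_invertible_def group_inverse_def by (blast intro: theI)

text \<open>On matrices, \<open>\<le>\<close> is the entrywise order, and it includes equality of the dimensions.\<close>

definition group_monotone :: "real mat \<Rightarrow> bool" where
  "group_monotone A \<longleftrightarrow>
     group_invertible A \<and> 0\<^sub>m (dim_row A) (dim_row A) \<le> group_inverse A"

definition proper_splitting :: "real mat \<Rightarrow> real mat \<Rightarrow> real mat \<Rightarrow> bool" where
  "proper_splitting A U V \<longleftrightarrow>
     U \<in> carrier_mat (dim_row A) (dim_col A) \<and>
     V \<in> carrier_mat (dim_row A) (dim_col A) \<and>
     A = U - V \<and> mat_range U = mat_range A \<and> mat_kernel U = mat_kernel A"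

definition proper_G_weak_regular_splitting_II :: "real mat \<Rightarrow> real mat \<Rightarrow> real mat \<Rightarrow> bool" where
  "proper_G_weak_regular_splitting_II A U V \<longleftrightarrow>
     proper_splitting A U V \<and> group_invertible U \<and>
     0\<^sub>m (dim_row A) (dim_row A) \<le> group_inverse U \<and>
     0\<^sub>m (dim_row A) (dim_row A) \<le> V * group_inverse U"

definition real_spectral_radius :: "real mat \<Rightarrow> real" where
  "real_spectral_radius A = spectral_radius (map_mat complex_of_real A)"

end

theory Submission
  imports Defs
begin

text \<open>
  On the common range \<open>R\<close> of \<open>A, K, U, X\<close> all four matrices are invertible, and conjugation by
  \<open>A\<close> turns the iteration matrix \<open>H\<close> into \<open>T = (Y X\<^sup>#) (V U\<^sup>#) (L K\<^sup>#)\<close>, which is nonnegative.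
  Since \<open>A\<^sup># (V U\<^sup>#) = A\<^sup># - U\<^sup>#\<close>, and similarly for the other two splittings, telescoping gives
  \<open>A\<^sup># - A\<^sup># T \<ge> K\<^sup># \<ge> 0\<close>. Multiplying by \<open>T\<^sup>k\<close> and summing over \<open>k\<close> bounds
  \<open>\<Sum>k. K\<^sup># T\<^sup>k\<close> entrywise by \<open>A\<^sup>#\<close>, so \<open>K\<^sup># T\<^sup>k\<close> tends to zero. As \<open>K\<^sup>#\<close> is injective on \<open>R\<close>, also
  \<open>T\<^sup>k\<close> and \<open>H\<^sup>k\<close> tend to zero. This avoids the Perron--Frobenius theorem.
\<close>

text \<open>Products must keep the bracketing in which the group inverse equations are stated;
  rebracketing is requested explicitly through \<open>as\<close>.\<close>

declare assoc_mult_mat[simp del]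

section \<open>Entrywise order, nonnegative products and powers\<close>

lemma nonneg_mat_index:
  fixes A :: "real mat"
  assumes "0\<^sub>m n m \<le> A" "i < n" "j < m"
  shows "0 \<le> A $$ (i, j)"
  using assms by (auto simp: less_eq_mat_def)

lemma mult_mat_nonneg:
  fixes A B :: "real mat"
  assumes "A \<in> carrier_mat n m" "B \<in> carrier_mat m l" "0\<^sub>m n m \<le> A" "0\<^sub>m m l \<le> B"
  shows "0\<^sub>m n l \<le> A * B"
  using assms by (auto simp: less_eq_mat_def scalar_prod_def intro!: sum_nonneg)

lemma mult_right_mono_mat:
  fixes A B C :: "real mat"
  assumes "A \<in> carrier_mat n m" "B \<in> carrier_mat n m" "C \<in> carrier_mat m l"
    and "A \<le> B" "0\<^sub>m m l \<le> C"
  shows "A * C \<le> B * C"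
  using assms
  by (auto simp: less_eq_mat_def scalar_prod_def intro!: sum_mono mult_right_mono)

lemma pow_mat_Suc_left:
  assumes "A \<in> carrier_mat n n"
  shows "A ^\<^sub>m Suc k = A * A ^\<^sub>m k"
proof (induction k)
  case (Suc k)
  then show ?case
    using assms by (metis assoc_mult_mat pow_carrier_mat pow_mat.simps(2))
qed (use assms in simp)

lemma pow_mat_nonneg:
  fixes A :: "real mat"
  assumes "A \<in> carrier_mat n n" "0\<^sub>m n n \<le> A"
  shows "0\<^sub>m n n \<le> A ^\<^sub>m k"
proof (induction k)
  case 0
  then show ?case using assms by (auto simp: less_eq_mat_def)
next
  case (Suc k)
  then show ?case using assms by (auto intro!: mult_mat_nonneg)
qed

lemma mult_mat_tendsto_0:
  fixes M N :: "real mat" and F :: "nat \<Rightarrow> real mat"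
  assumes "M \<in> carrier_mat n n" "N \<in> carrier_mat n n" "\<And>k. F k \<in> carrier_mat n n"
    and "\<And>i j. i < n \<Longrightarrow> j < n \<Longrightarrow> (\<lambda>k. F k $$ (i, j)) \<longlonglongrightarrow> 0"
    and "i < n" "j < n"
  shows "(\<lambda>k. (M * F k * N) $$ (i, j)) \<longlonglongrightarrow> 0"
proof -
  have "(M * F k * N) $$ (i, j) =
      (\<Sum>l = 0..<n. (\<Sum>p = 0..<n. M $$ (i, p) * F k $$ (p, l)) * N $$ (l, j))" for k
    using assms(1,2,5,6) assms(3)[of k] by (simp add: scalar_prod_def)
  then show ?thesis
    using assms(4) by (auto intro!: tendsto_null_sum tendsto_mult_left_zero tendsto_mult_right_zero)
qed

section \<open>Powers tending to zero and the spectral radius\<close>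

text \<open>On an eigenvector \<open>v\<close> of an eigenvalue \<open>c\<close> of maximal modulus,
  \<open>H ^\<^sub>m k\<close> acts as \<open>c ^ k\<close>; a nonzero entry of \<open>v\<close>
  then forces \<open>c ^ k\<close> to tend to 0.\<close>

lemma spectral_radius_less_1I:
  fixes H :: "complex mat"
  assumes H: "H \<in> carrier_mat n n" and n: "n > 0"
    and lim: "\<And>i j. i < n \<Longrightarrow> j < n \<Longrightarrow> (\<lambda>k. (H ^\<^sub>m k) $$ (i, j)) \<longlonglongrightarrow> 0"
  shows "spectral_radius H < 1"
proof -
  \<comment> \<open>\<open>n > 0\<close> makes the spectrum nonempty, so the maximum is
    attained.\<close>
  obtain c where c: "c \<in> spectrum H" "spectral_radius H = norm c"
    using spectral_radius_mem_max(1)[OF H n] by blast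
  then obtain v where v: "eigenvector H v c"
    by (auto simp: spectrum_def eigenvalue_def)
  then have vc: "v \<in> carrier_vec n" "v \<noteq> 0\<^sub>v n"
    using H by (auto simp: eigenvector_def)
  then obtain i where i: "i < n" "v $ i \<noteq> 0" by (metis eq_vecI carrier_vecD index_zero_vec)
  have "c ^ k * v $ i = (\<Sum>j = 0..<n. (H ^\<^sub>m k) $$ (i, j) * v $ j)" for k
  proof -
    have "c ^ k * v $ i = (H ^\<^sub>m k *\<^sub>v v) $ i"
      using eigenvector_pow[OF H v, of k] vc i by simp
    also have "\<dots> = (\<Sum>j = 0..<n. (H ^\<^sub>m k) $$ (i, j) * v $ j)"
      using vc i H by (simp add: scalar_prod_def)
    finally show ?thesis .
  qed
  then have "(\<lambda>k. c ^ k * v $ i) \<longlonglongrightarrow> 0"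
    using i(1) by (auto intro!: tendsto_null_sum tendsto_mult_left_zero lim)
  then have "(\<lambda>k. c ^ k * v $ i / v $ i) \<longlonglongrightarrow> 0 / v $ i"
    using i(2) by (intro tendsto_divide) auto
  then have "(\<lambda>k. c ^ k) \<longlonglongrightarrow> 0" using i(2) by simp
  then have "eventually (\<lambda>k. norm (c ^ k) < 1) sequentially"
    using order_tendstoD(2)[OF tendsto_norm_zero] by fastforce
  \<comment> \<open>One such power suffices: all powers of a number at least 1 stay at least
    1.\<close>
  then obtain k where "norm c ^ k < 1" by (auto simp: norm_power dest: eventually_happens)
  then have "norm c < 1" using one_le_power[of "norm c" k] by linarith
  then show ?thesis using c(2) by simp
qed

lemma real_spectral_radius_less_1I:
  fixes H :: "real mat"
  assumes H: "H \<in> carrier_mat n n" and n: "n > 0"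
    and lim: "\<And>i j. i < n \<Longrightarrow> j < n \<Longrightarrow> (\<lambda>k. (H ^\<^sub>m k) $$ (i, j)) \<longlonglongrightarrow> 0"
  shows "real_spectral_radius H < 1"
  unfolding real_spectral_radius_def
proof (rule spectral_radius_less_1I[OF _ n])
  show "map_mat complex_of_real H \<in> carrier_mat n n" using H by simp
  fix i j assume ij: "i < n" "j < n"
  have "(map_mat complex_of_real H ^\<^sub>m k) $$ (i, j) = complex_of_real ((H ^\<^sub>m k) $$ (i, j))" for k
    using ij H by (simp flip: of_real_hom.mat_hom_pow[OF H])
  then show "(\<lambda>k. (map_mat complex_of_real H ^\<^sub>m k) $$ (i, j)) \<longlonglongrightarrow> 0"
    using tendsto_of_real[OF lim[OF ij], where 'a = complex] by simp
qed

text \<open>Multiplying \<open>le\<close> by \<open>T ^\<^sub>m k\<close> bounds each term by a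
  difference of consecutive entries of \<open>G * T ^\<^sub>m k\<close>. The partial sums telescope
  and stay below an entry of \<open>G\<close>, so a nonnegative series converges and its terms
  vanish in the limit.\<close>

lemma mult_pow_mat_tendsto_0:
  fixes G N T :: "real mat"
  assumes G: "G \<in> carrier_mat n n" "0\<^sub>m n n \<le> G"
    and N: "N \<in> carrier_mat n n" "0\<^sub>m n n \<le> N"
    and T: "T \<in> carrier_mat n n" "0\<^sub>m n n \<le> T"
    and le: "N \<le> G - G * T"
    and ij: "i < n" "j < n"
  shows "(\<lambda>k. (N * T ^\<^sub>m k) $$ (i, j)) \<longlonglongrightarrow> 0"
proof -
  note pow = pow_carrier_mat[OF T(1)]
  define g where "g k = (G * T ^\<^sub>m k) $$ (i, j)" for k
  have nonneg: "0 \<le> (N * T ^\<^sub>m k) $$ (i, j)" for k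
    using mult_mat_nonneg[OF N(1) pow N(2) pow_mat_nonneg[OF T]] ij
    by (rule nonneg_mat_index)
  have g: "0 \<le> g k" for k
    using mult_mat_nonneg[OF G(1) pow G(2) pow_mat_nonneg[OF T]] ij
    unfolding g_def by (rule nonneg_mat_index)
  have step: "(N * T ^\<^sub>m k) $$ (i, j) \<le> g k - g (Suc k)" for k
  proof -
    have "(G - G * T) * T ^\<^sub>m k = G * T ^\<^sub>m k - G * T * T ^\<^sub>m k"
      using G(1) T(1) pow by (intro minus_mult_distrib_mat) auto
    also have "G * T * T ^\<^sub>m k = G * T ^\<^sub>m Suc k"
      unfolding pow_mat_Suc_left[OF T(1)] using G(1) T(1) pow by (intro assoc_mult_mat) auto
    finally have eq: "(G - G * T) * T ^\<^sub>m k = G * T ^\<^sub>m k - G * T ^\<^sub>m Suc k" .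
    have "N * T ^\<^sub>m k \<le> (G - G * T) * T ^\<^sub>m k"
      using G(1) T(1) by (intro mult_right_mono_mat[OF N(1) _ pow le pow_mat_nonneg[OF T]]) auto
    then have "(N * T ^\<^sub>m k) $$ (i, j) \<le> (G * T ^\<^sub>m k - G * T ^\<^sub>m Suc k) $$ (i, j)"
      unfolding eq using ij G(1) T(1) by (auto simp: less_eq_mat_def simp del: pow_mat.simps)
    also have "\<dots> = g k - g (Suc k)"
      unfolding g_def using ij G(1) T(1) by (subst index_minus_mat) auto
    finally show ?thesis .
  qed
  have "(\<Sum>k<m. (N * T ^\<^sub>m k) $$ (i, j)) \<le> g 0" for m
  proof -
    have "(\<Sum>k<m. (N * T ^\<^sub>m k) $$ (i, j)) \<le> (\<Sum>k<m. g k - g (Suc k))"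
      by (intro sum_mono step)
    also have "\<dots> = g 0 - g m" by (rule sum_lessThan_telescope')
    finally show ?thesis using g[of m] by simp
  qed
  then have "summable (\<lambda>k. (N * T ^\<^sub>m k) $$ (i, j))"
    by (intro summableI_nonneg_bounded nonneg)
  then show ?thesis by (rule summable_LIMSEQ_zero)
qed

section \<open>Group inverses and proper splittings\<close>

lemma mat_eqI_mult_vec:
  fixes A B :: "real mat"
  assumes "A \<in> carrier_mat n m" "B \<in> carrier_mat n m"
    and "\<And>x. x \<in> carrier_vec m \<Longrightarrow> A *\<^sub>v x = B *\<^sub>v x"
  shows "A = B"
proof (rule eq_matI)
  fix i j assume ij: "i < dim_row B" "j < dim_col B"
  have "A *\<^sub>v unit_vec m j = B *\<^sub>v unit_vec m j" by (rule assms(3)) simp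
  then have "(A *\<^sub>v unit_vec m j) $ i = (B *\<^sub>v unit_vec m j) $ i" by simp
  then show "A $$ (i, j) = B $$ (i, j)" using ij assms(1,2) by simp
qed (use assms in auto)

text \<open>\<open>A * G\<close> is a projector fixing the range of \<open>A\<close>, because
  \<open>A * G * A = A\<close>; so it fixes every column of \<open>U\<close>.\<close>

lemma range_subset_group_inverse:
  assumes A: "A \<in> carrier_mat n n" "is_group_inverse A G"
    and U: "U \<in> carrier_mat n n" and sub: "mat_range U \<subseteq> mat_range A"
  shows "A * G * U = U"
proof (rule mat_eqI_mult_vec[of _ n n])
  have G: "G \<in> carrier_mat n n" "A * G * A = A"
    using A by (auto simp: is_group_inverse_def)
  show "A * G * U \<in> carrier_mat n n" "U \<in> carrier_mat n n" using A G U by auto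
  fix x :: "real vec" assume x: "x \<in> carrier_vec n"
  then have "U *\<^sub>v x \<in> mat_range A" using sub U by (auto simp: mat_range_def)
  then obtain y where y: "y \<in> carrier_vec n" "U *\<^sub>v x = A *\<^sub>v y"
    using A by (auto simp: mat_range_def)
  have "A * G * U *\<^sub>v x = A * G *\<^sub>v (A *\<^sub>v y)"
    using A G U x y by (metis assoc_mult_mat_vec mult_carrier_mat)
  also have "\<dots> = A * G * A *\<^sub>v y"
    using A G y by (metis assoc_mult_mat_vec mult_carrier_mat)
  finally show "A * G * U *\<^sub>v x = U *\<^sub>v x" using G y by simp
qed

text \<open>The projector \<open>A * G\<close> changes a vector only by an element of the kernel of
  \<open>A\<close>, which \<open>U\<close> does not see.\<close>

lemma kernel_subset_group_inverse:
  assumes A: "A \<in> carrier_mat n n" "is_group_inverse A G"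
    and U: "U \<in> carrier_mat n n" and sub: "mat_kernel A \<subseteq> mat_kernel U"
  shows "U * (A * G) = U"
proof (rule mat_eqI_mult_vec[of _ n n])
  have G: "G \<in> carrier_mat n n" "A * G * A = A" "A * G = G * A"
    using A by (auto simp: is_group_inverse_def)
  show "U * (A * G) \<in> carrier_mat n n" "U \<in> carrier_mat n n" using A G U by auto
  fix x :: "real vec" assume x: "x \<in> carrier_vec n"
  define y where "y = A * G *\<^sub>v x"
  have y: "y \<in> carrier_vec n" using A G x by (simp add: y_def)
  have "A * (A * G) = A" using A G by (simp flip: assoc_mult_mat[of _ n n _ n _ n])
  then have "A *\<^sub>v y = A *\<^sub>v x" unfolding y_def
    using A G x by (metis assoc_mult_mat_vec mult_carrier_mat)
  then have "A *\<^sub>v (x - y) = 0\<^sub>v n"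
    using A x y by (auto simp: mult_minus_distrib_mat_vec)
  then have "x - y \<in> mat_kernel A" using A x y by (intro mat_kernelI[of _ n n]) auto
  then have "x - y \<in> mat_kernel U" using sub by blast
  then have "U *\<^sub>v x - U *\<^sub>v y = 0\<^sub>v n"
    using U x y by (simp add: mat_kernel_def mult_minus_distrib_mat_vec)
  then have "U *\<^sub>v x = U *\<^sub>v y"
    using U x y by (auto simp: vec_eq_iff)
  then show "U * (A * G) *\<^sub>v x = U *\<^sub>v x"
    using U A G x by (metis assoc_mult_mat_vec mult_carrier_mat y_def)
qed

text \<open>\<open>A\<close> and \<open>U\<close> share range and kernel, hence also the projector
  \<open>A * G = U * W\<close>. The third equation drives the telescoping; the fourth lets
  \<open>A\<close> pass through an iteration matrix.\<close>

lemma proper_splitting_group_inverse: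
  assumes A: "A \<in> carrier_mat n n" "is_group_inverse A G"
    and sp: "proper_splitting A U V" and W: "is_group_inverse U W"
  shows "U * W = A * G" "A * G * V = V" "G * (V * W) = G - W" "A * (W * V) = V * W * A"
proof -
  note as = assoc_mult_mat[of _ n n _ n _ n]
  have U: "U \<in> carrier_mat n n" and V: "V \<in> carrier_mat n n" and AUV: "A = U - V"
    and r: "mat_range U = mat_range A" and k: "mat_kernel U = mat_kernel A"
    using A sp by (auto simp: proper_splitting_def)
  have G: "G \<in> carrier_mat n n" "A * G * A = A" "G * A * G = G" "A * G = G * A"
    using A by (auto simp: is_group_inverse_def)
  have Wc: "W \<in> carrier_mat n n" "U * W * U = U" "W * U * W = W" "U * W = W * U"
    using W U by (auto simp: is_group_inverse_def)
  note c = A(1) U V G(1) Wc(1)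
  have 1: "A * G * U = U" by (rule range_subset_group_inverse[OF A U]) (simp add: r)
  have 2: "U * W * A = A" by (rule range_subset_group_inverse[OF U W A(1)]) (simp add: r)
  have 3: "U * (A * G) = U" by (rule kernel_subset_group_inverse[OF A U]) (simp add: k)
  \<comment> \<open>Equality of kernels inserts \<open>A * G\<close> on the right; equality of
    ranges then absorbs \<open>U * W\<close> on the left.\<close>
  have "U * W = W * (U * (A * G))" using Wc(4) 3 by simp
  also have "\<dots> = W * U * A * G" using c by (simp add: as)
  also have "\<dots> = A * G" using 2 Wc(4) by simp
  finally show P: "U * W = A * G" .
  have V_eq: "V = U - A" using U V unfolding AUV by (intro eq_matI) auto
  have "A * G * V = A * G * U - A * G * A"
    unfolding V_eq using c by (intro mult_minus_distrib_mat[of _ n n]) auto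
  then show "A * G * V = V" using 1 G(2) V_eq by simp
  have VW: "V * W = A * G - A * W"
    unfolding V_eq P[symmetric] using c by (intro minus_mult_distrib_mat) auto
  have "G * (A * G - A * W) = G * (A * G) - G * (A * W)"
    using c by (intro mult_minus_distrib_mat[of _ n n]) auto
  also have "G * (A * G) = G" using c G(3) by (simp add: as)
  also have "G * (A * W) = A * G * W" using c G(4) by (simp flip: as)
  also have "\<dots> = W" unfolding P[symmetric] using Wc(3,4) by simp
  finally show "G * (V * W) = G - W" unfolding VW .
  \<comment> \<open>Both sides equal \<open>A - A * W * A\<close>.\<close>
  have "A * (W * V) = A * (W * U) - A * (W * A)"
    unfolding V_eq using c by (simp add: mult_minus_distrib_mat[of _ n n _ n])
  also have "A * (W * U) = A * (G * A)" by (simp only: Wc(4)[symmetric] P G(4))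
  also have "\<dots> = A * G * A" using c by (simp add: as)
  also have "A * G * A - A * (W * A) = (A * G - A * W) * A"
    using c by (simp add: minus_mult_distrib_mat[of _ n n _ _ n] as)
  finally show "A * (W * V) = V * W * A" unfolding VW .
qed

section \<open>Convergence of the three-step iteration\<close>

theorem theorem3p5:
  fixes n :: nat and A K L U V X Y :: "real mat"
  assumes "n \<ge> 1"
    and "A \<in> carrier_mat n n"
    and "group_monotone A"
    and "proper_G_weak_regular_splitting_II A K L"
    and "proper_G_weak_regular_splitting_II A U V"
    and "proper_G_weak_regular_splitting_II A X Y"
  shows "real_spectral_radius
    (group_inverse X * Y * group_inverse U * V * group_inverse K * L) < 1"
proof -
  note as = assoc_mult_mat[of _ n n _ n _ n]
  define G where "G = group_inverse A"
  define Kg where "Kg = group_inverse K"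
  define Ug where "Ug = group_inverse U"
  define Xg where "Xg = group_inverse X"
  note A = assms(2)
  have G: "is_group_inverse A G" "0\<^sub>m n n \<le> G"
    using assms(2,3) is_group_inverse_group_inverse by (auto simp: group_monotone_def G_def)
  have K: "proper_splitting A K L" "is_group_inverse K Kg" "0\<^sub>m n n \<le> Kg" "0\<^sub>m n n \<le> L * Kg"
    and U: "proper_splitting A U V" "is_group_inverse U Ug" "0\<^sub>m n n \<le> Ug" "0\<^sub>m n n \<le> V * Ug"
    and X: "proper_splitting A X Y" "is_group_inverse X Xg" "0\<^sub>m n n \<le> Xg" "0\<^sub>m n n \<le> Y * Xg"
    using assms(2,4-6) is_group_inverse_group_inverse
    by (auto simp: proper_G_weak_regular_splitting_II_def Kg_def Ug_def Xg_def)
  have c: "A \<in> carrier_mat n n" "G \<in> carrier_mat n n"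
    "K \<in> carrier_mat n n" "L \<in> carrier_mat n n" "Kg \<in> carrier_mat n n"
    "U \<in> carrier_mat n n" "V \<in> carrier_mat n n" "Ug \<in> carrier_mat n n"
    "X \<in> carrier_mat n n" "Y \<in> carrier_mat n n" "Xg \<in> carrier_mat n n"
    using A G(1) K(1,2) U(1,2) X(1,2) by (auto simp: proper_splitting_def is_group_inverse_def)
  note sK = proper_splitting_group_inverse[OF A G(1) K(1,2)]
  note sU = proper_splitting_group_inverse[OF A G(1) U(1,2)]
  note sX = proper_splitting_group_inverse[OF A G(1) X(1,2)]
  have P: "A * G = G * A" using G(1) by (simp add: is_group_inverse_def)
  define S1 where "S1 = Y * Xg"
  define S2 where "S2 = V * Ug"
  define S3 where "S3 = L * Kg"
  define T where "T = S1 * S2 * S3"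
  define H where "H = Xg * Y * Ug * V * Kg * L"
  have S: "S1 \<in> carrier_mat n n" "S2 \<in> carrier_mat n n" "S3 \<in> carrier_mat n n"
    using c by (auto simp: S1_def S2_def S3_def)
  have S0: "0\<^sub>m n n \<le> S1" "0\<^sub>m n n \<le> S2" "0\<^sub>m n n \<le> S3"
    using K U X by (auto simp: S1_def S2_def S3_def)
  have T: "T \<in> carrier_mat n n" "0\<^sub>m n n \<le> T"
    using S S0 by (auto simp: T_def intro!: mult_mat_nonneg[of _ n n])
  have H: "H \<in> carrier_mat n n" unfolding H_def using c by (intro mult_carrier_mat[of _ n n]) auto
  \<comment> \<open>\<open>G\<close> absorbs \<open>S1\<close>, \<open>S2\<close>, \<open>S3\<close>
    in turn, each time leaving a subtracted group inverse; only the last one, \<open>Kg\<close>, has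
    no further factor behind it.\<close>
  have "G * T = G * S1 * S2 * S3" using c S by (simp add: T_def as)
  also have "\<dots> = (G - Xg) * S2 * S3" using sX(3) by (simp add: S1_def)
  also have "\<dots> = (G - Ug - Xg * S2) * S3"
    using c S sU(3)[folded S2_def] by (simp add: minus_mult_distrib_mat[of _ n n _ _ n])
  also have "\<dots> = G - Kg - Ug * S3 - Xg * S2 * S3"
    using c S sK(3)[folded S3_def]
    by (simp add: minus_mult_distrib_mat[of _ n n _ _ n] mult_carrier_mat[of _ n n]
        minus_carrier_mat)
  finally have GT: "G * T = G - Kg - Ug * S3 - Xg * S2 * S3" .
  have pos: "0\<^sub>m n n \<le> Ug * S3" "0\<^sub>m n n \<le> Xg * S2 * S3"
    using c S S0 U X by (auto intro!: mult_mat_nonneg[of _ n n])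
  \<comment> \<open>\<open>G - G * T\<close> is \<open>Kg\<close> plus the two nonnegative products
    in \<open>pos\<close>.\<close>
  have le: "Kg \<le> G - G * T"
    using pos c S unfolding GT by (auto simp: less_eq_mat_def simp del: index_mult_mat(1))
  have KT: "(\<lambda>k. (Kg * T ^\<^sub>m k) $$ (i, j)) \<longlonglongrightarrow> 0" if "i < n" "j < n" for i j
    by (rule mult_pow_mat_tendsto_0[OF c(2) G(2) c(5) K(3) T le that])
  \<comment> \<open>\<open>A\<close> moves right past one splitting at a time, reversing the two
    factors of each.\<close>
  have AH: "A * H = T * A"
  proof -
    have "A * H = A * (Xg * Y) * (Ug * V) * (Kg * L)" using c by (simp add: H_def as)
    also have "\<dots> = S1 * (A * (Ug * V)) * (Kg * L)" using c S by (simp add: sX(4) S1_def as)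
    also have "\<dots> = S1 * S2 * (A * (Kg * L))" using c S by (simp add: sU(4) S2_def as)
    also have "\<dots> = T * A" using c S by (simp add: sK(4) S3_def T_def as)
    finally show ?thesis .
  qed
  have AHk: "A * H ^\<^sub>m k = T ^\<^sub>m k * A" for k
  proof (induction k)
    case (Suc k)
    have "A * H ^\<^sub>m Suc k = A * H ^\<^sub>m k * H" using c H by (simp add: as)
    also have "\<dots> = T ^\<^sub>m k * (A * H)" unfolding Suc using c H T by (simp add: as)
    also have "\<dots> = T ^\<^sub>m Suc k * A" unfolding AH using c T by (simp add: as)
    finally show ?case .
  qed (use c H T in simp)
  have PXg: "A * G * Xg = Xg" using X(2) sX(1) by (simp add: is_group_inverse_def)
  have "A * G * H = A * G * Xg * (Y * Ug * V * Kg * L)" using c by (simp add: H_def as)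
  then have PH: "A * G * H = H" unfolding PXg using c by (simp add: H_def as)
  \<comment> \<open>The exponent starts at 1: for exponent 0 the right side would be the projector
    \<open>A * G\<close> instead of the identity. Since \<open>K * Kg = A * G\<close> fixes
    \<open>T\<close>, multiplying by \<open>K\<close> undoes \<open>Kg\<close>, and \<open>G\<close>
    likewise undoes \<open>A\<close> on the range containing that of \<open>H\<close>.\<close>
  have Hk: "H ^\<^sub>m Suc k = G * K * (Kg * T ^\<^sub>m Suc k) * A" for k
  proof -
    note pow = pow_carrier_mat[OF H] pow_carrier_mat[OF T(1)]
    \<comment> \<open>The leftmost factor \<open>Y\<close> of \<open>T\<close> already has its range
      inside that of \<open>A\<close>.\<close>
    have "A * G * T = (A * G * Y) * (Xg * S2 * S3)"
      using c S by (simp add: T_def S1_def as)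
    then have PT: "A * G * T = T" using c S by (simp add: sX(2) T_def S1_def as)
    have "H ^\<^sub>m Suc k = A * G * H * H ^\<^sub>m k" unfolding PH pow_mat_Suc_left[OF H] ..
    also have "\<dots> = G * (A * (H * H ^\<^sub>m k))" unfolding P using c H pow by (simp add: as)
    also have "\<dots> = G * (T ^\<^sub>m Suc k * A)"
      unfolding pow_mat_Suc_left[OF H, symmetric] AHk ..
    also have "T ^\<^sub>m Suc k = K * Kg * T * T ^\<^sub>m k"
      unfolding sK(1) PT pow_mat_Suc_left[OF T(1)] ..
    also have "\<dots> = K * (Kg * T ^\<^sub>m Suc k)"
      unfolding pow_mat_Suc_left[OF T(1)] using c T pow by (simp add: as)
    finally show ?thesis using c T pow by (simp add: as mult_carrier_mat[of _ n n])
  qed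
  have "(\<lambda>k. (H ^\<^sub>m k) $$ (i, j)) \<longlonglongrightarrow> 0" if ij: "i < n" "j < n" for i j
  proof (rule LIMSEQ_imp_Suc)
    have "(\<lambda>k. (G * K * (Kg * T ^\<^sub>m Suc k) * A) $$ (i, j)) \<longlonglongrightarrow> 0"
    proof (rule mult_mat_tendsto_0[OF _ A _ _ ij])
      show "(\<lambda>k. (Kg * T ^\<^sub>m Suc k) $$ (p, q)) \<longlonglongrightarrow> 0" if "p < n" "q < n" for p q
        using LIMSEQ_Suc[OF KT[OF that]] .
    qed (use c T in auto)
    then show "(\<lambda>k. (H ^\<^sub>m Suc k) $$ (i, j)) \<longlonglongrightarrow> 0" unfolding Hk .
  qed
  then have "real_spectral_radius H < 1"
    using assms(1) H by (intro real_spectral_radius_less_1I) auto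
  then show ?thesis by (simp add: H_def Kg_def Ug_def Xg_def)
qed

end
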